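(* Let $\alpha:A\to C$ and $\beta:B\to C$ be ring homomorphisms, and let $p_A:\alpha\times_C\beta\to A$ be the restriction to $\alpha\times_C\beta$ of the projection $A\times B\to A$. Then the following conditions are equivalent. (i) $p_A:\alpha\times_C\beta\to A$ is a ring retraction. (ii) There exist an ideal $J$ of $B$ and a ring homomorphism $f:A\to B$ such that $\alpha\times_C\beta=A\Join^f J$ (equality of subrings of $A\times B$).
   Context: All rings are commutative with identity and ring homomorphisms preserve the identity. For a ring homomorphism $f:A\to B$ and an ideal $J$ of $B$, the amalgamation of $A$ with $B$ along $J$ with respect to $f$ is the subring $A\Join^f J:=\{(a,f(a)+j)\mid a\in A,\ j\in J\}$ of $A\times B$. For ring homomorphisms $\alpha:A\to C$ and $\beta:B\to C$, the pullback (or fiber product) of $\alpha$ and $\beta$ is the subring $\alpha\times_C\beta:=\{(a,b)\in A\times B\mid \alpha(a)=\beta(b)\}$ of $A\times B$. A ring homomorphism $r:S\to R$ is called a ring retraction if there exists a ring homomorphism $\iota:R\to S$ such that $r\circ\iota=\mathrm{id}_R$. *)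

theory Defs
  imports "HOL-Algebra.Algebra"
begin

definition amalgamation ::
    "('a, 'm) ring_scheme \<Rightarrow> ('b, 'n) ring_scheme \<Rightarrow> ('a \<Rightarrow> 'b) \<Rightarrow> 'b set \<Rightarrow> ('a \<times> 'b) ring"
  where "amalgamation A B f J =
    (RDirProd A B)\<lparr>carrier := {(a, f a \<oplus>\<^bsub>B\<^esub> j) | a j. a \<in> carrier A \<and> j \<in> J}\<rparr>"

text \<open>The codomain \<open>C\<close> of \<open>\<alpha>\<close> and \<open>\<beta>\<close> is not an argument: it enters the pullback only
  through the values of the two homomorphisms.\<close>

definition pullback ::
    "('a, 'm) ring_scheme \<Rightarrow> ('b, 'n) ring_scheme \<Rightarrow> ('a \<Rightarrow> 'c) \<Rightarrow> ('b \<Rightarrow> 'c) \<Rightarrow> ('a \<times> 'b) ring"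
  where "pullback A B \<alpha> \<beta> =
    (RDirProd A B)\<lparr>carrier := {(a, b). a \<in> carrier A \<and> b \<in> carrier B \<and> \<alpha> a = \<beta> b}\<rparr>"

definition ring_retraction ::
    "('s, 'm) ring_scheme \<Rightarrow> ('r, 'n) ring_scheme \<Rightarrow> ('s \<Rightarrow> 'r) \<Rightarrow> bool"
  where "ring_retraction S R r \<longleftrightarrow>
    ring_hom_cring S R r \<and> (\<exists>\<iota> \<in> ring_hom R S. \<forall>x \<in> carrier R. (r \<circ> \<iota>) x = x)"

lemma RDirProd_simps:
  "(a, b) \<oplus>\<^bsub>RDirProd A B\<^esub> (a', b') = (a \<oplus>\<^bsub>A\<^esub> a', b \<oplus>\<^bsub>B\<^esub> b')"
  "(a, b) \<otimes>\<^bsub>RDirProd A B\<^esub> (a', b') = (a \<otimes>\<^bsub>A\<^esub> a', b \<otimes>\<^bsub>B\<^esub> b')"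
  "\<one>\<^bsub>RDirProd A B\<^esub> = (\<one>\<^bsub>A\<^esub>, \<one>\<^bsub>B\<^esub>)"
  "\<zero>\<^bsub>RDirProd A B\<^esub> = (\<zero>\<^bsub>A\<^esub>, \<zero>\<^bsub>B\<^esub>)"
  by (auto simp: RDirProd_def DirProd_def monoid.defs)

lemma RDirProd_cring:
  assumes "cring A" "cring B"
  shows "cring (RDirProd A B)"
proof -
  interpret A: cring A by fact
  interpret B: cring B by fact
  interpret P: ring "RDirProd A B"
    by (rule RDirProd_ring[OF A.ring_axioms B.ring_axioms])
  show ?thesis
    by unfold_locales (auto simp: RDirProd_carrier RDirProd_simps A.m_comm B.m_comm)
qed

lemma RDirProd_minus:
  assumes "cring A" "cring B" "a \<in> carrier A" "b \<in> carrier B"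
  shows "\<ominus>\<^bsub>RDirProd A B\<^esub> (a, b) = (\<ominus>\<^bsub>A\<^esub> a, \<ominus>\<^bsub>B\<^esub> b)"
proof -
  interpret A: cring A by fact
  interpret B: cring B by fact
  interpret P: cring "RDirProd A B" by (rule RDirProd_cring) fact+
  show ?thesis
    by (rule P.minus_equality)
      (use assms in \<open>auto simp: RDirProd_carrier RDirProd_simps A.l_neg B.l_neg\<close>)
qed

lemma pullback_subring:
  assumes "ring_hom_cring A C \<alpha>" "ring_hom_cring B C \<beta>"
  shows "subring (carrier (pullback A B \<alpha> \<beta>)) (RDirProd A B)"
proof -
  interpret f: ring_hom_cring A C \<alpha> by fact
  interpret g: ring_hom_cring B C \<beta> by fact
  interpret P: cring "RDirProd A B"
    by (rule RDirProd_cring) (rule f.R.is_cring g.R.is_cring)+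
  show ?thesis
    by (rule P.subringI)
      (auto simp: pullback_def RDirProd_carrier RDirProd_simps
        RDirProd_minus[OF f.R.is_cring g.R.is_cring])
qed

lemma amalgamation_subring:
  assumes "ring_hom_cring A B f" "ideal J B"
  shows "subring (carrier (amalgamation A B f J)) (RDirProd A B)"
proof -
  interpret f: ring_hom_cring A B f by fact
  interpret J: ideal J B by fact
  interpret P: cring "RDirProd A B"
    by (rule RDirProd_cring) (rule f.R.is_cring f.S.is_cring)+
  have mem: "(a, b) \<in> carrier (amalgamation A B f J) \<longleftrightarrow>
      a \<in> carrier A \<and> (\<exists>j \<in> J. b = f a \<oplus>\<^bsub>B\<^esub> j)" for a b
    by (auto simp: amalgamation_def)
  show ?thesis
  proof (rule P.subringI)
    show "carrier (amalgamation A B f J) \<subseteq> carrier (RDirProd A B)"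
      by (auto simp: amalgamation_def RDirProd_carrier)
    show "\<one>\<^bsub>RDirProd A B\<^esub> \<in> carrier (amalgamation A B f J)"
      unfolding RDirProd_simps mem
      by (auto intro!: bexI[of _ "\<zero>\<^bsub>B\<^esub>"])
  next
    fix h assume "h \<in> carrier (amalgamation A B f J)"
    then obtain a j where h: "h = (a, f a \<oplus>\<^bsub>B\<^esub> j)" "a \<in> carrier A" "j \<in> J"
      by (auto simp: amalgamation_def)
    then show "\<ominus>\<^bsub>RDirProd A B\<^esub> h \<in> carrier (amalgamation A B f J)"
      by (auto simp: RDirProd_minus[OF f.R.is_cring f.S.is_cring] mem f.S.minus_add
          intro!: bexI[of _ "\<ominus>\<^bsub>B\<^esub> j"])
  next
    fix h k assume "h \<in> carrier (amalgamation A B f J)" "k \<in> carrier (amalgamation A B f J)"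
    then obtain a i b j where h: "h = (a, f a \<oplus>\<^bsub>B\<^esub> i)" "a \<in> carrier A" "i \<in> J"
      and k: "k = (b, f b \<oplus>\<^bsub>B\<^esub> j)" "b \<in> carrier A" "j \<in> J"
      by (auto simp: amalgamation_def)
    note [simp] = h k
    have [simp]: "i \<in> carrier B" "j \<in> carrier B" by (auto intro: J.Icarr h k)
    show "h \<oplus>\<^bsub>RDirProd A B\<^esub> k \<in> carrier (amalgamation A B f J)"
      by (auto simp: RDirProd_simps mem f.S.a_ac intro!: bexI[of _ "i \<oplus>\<^bsub>B\<^esub> j"])
    let ?l = "f a \<otimes>\<^bsub>B\<^esub> j \<oplus>\<^bsub>B\<^esub> i \<otimes>\<^bsub>B\<^esub> (f b \<oplus>\<^bsub>B\<^esub> j)"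
    have "?l \<in> J" by (intro J.a_closed J.I_l_closed J.I_r_closed) simp_all
    moreover have "(f a \<oplus>\<^bsub>B\<^esub> i) \<otimes>\<^bsub>B\<^esub> (f b \<oplus>\<^bsub>B\<^esub> j) = f (a \<otimes>\<^bsub>A\<^esub> b) \<oplus>\<^bsub>B\<^esub> ?l"
      by (simp add: f.S.l_distr f.S.r_distr f.S.a_ac)
    ultimately show "h \<otimes>\<^bsub>RDirProd A B\<^esub> k \<in> carrier (amalgamation A B f J)"
      by (auto simp: RDirProd_simps mem)
  qed
qed

end

theory Submission
  imports Defs
begin

text \<open>A section of the projection has the form \<open>a \<mapsto> (a, f a)\<close> for a homomorphism \<open>f\<close> with
  \<open>\<beta> \<circ> f = \<alpha>\<close>. Hence \<open>\<alpha> a = \<beta> b\<close> says that \<open>b\<close> and \<open>f a\<close> differ by an element of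
  \<open>J = ker \<beta>\<close>. Conversely, in \<open>amalgamation A B f J\<close> the map \<open>a \<mapsto> (a, f a)\<close> is a section.\<close>

lemma pullback_simps:
  "carrier (pullback A B \<alpha> \<beta>) = {(a, b). a \<in> carrier A \<and> b \<in> carrier B \<and> \<alpha> a = \<beta> b}"
  "x \<oplus>\<^bsub>pullback A B \<alpha> \<beta>\<^esub> y = x \<oplus>\<^bsub>RDirProd A B\<^esub> y"
  "x \<otimes>\<^bsub>pullback A B \<alpha> \<beta>\<^esub> y = x \<otimes>\<^bsub>RDirProd A B\<^esub> y"
  "\<one>\<^bsub>pullback A B \<alpha> \<beta>\<^esub> = \<one>\<^bsub>RDirProd A B\<^esub>"
  by (simp_all add: pullback_def)

text \<open>Both records are \<open>RDirProd A B\<close> with only the carrier replaced, so they can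
  differ in nothing but the carrier.\<close>

lemma pullback_eq_amalgamation_iff:
  "pullback A B \<alpha> \<beta> = amalgamation A B f J \<longleftrightarrow>
    {(a, b). a \<in> carrier A \<and> b \<in> carrier B \<and> \<alpha> a = \<beta> b} =
    {(a, f a \<oplus>\<^bsub>B\<^esub> j) | a j. a \<in> carrier A \<and> j \<in> J}" (is "_ \<longleftrightarrow> ?L = ?R")
proof
  assume "pullback A B \<alpha> \<beta> = amalgamation A B f J"
  then have "carrier (pullback A B \<alpha> \<beta>) = carrier (amalgamation A B f J)" by simp
  then show "?L = ?R" by (simp add: pullback_def amalgamation_def)
qed (simp add: pullback_def amalgamation_def)

lemma pullback_cring:
  assumes "ring_hom_cring A C \<alpha>" "ring_hom_cring B C \<beta>"
  shows "cring (pullback A B \<alpha> \<beta>)"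
proof -
  interpret f: ring_hom_cring A C \<alpha> by fact
  interpret g: ring_hom_cring B C \<beta> by fact
  interpret P: cring "RDirProd A B"
    by (rule RDirProd_cring) (rule f.R.is_cring g.R.is_cring)+
  interpret S: subcring "carrier (pullback A B \<alpha> \<beta>)" "RDirProd A B"
    by (rule P.subcringI'[OF pullback_subring[OF assms]])
  \<comment> \<open>This is the shape to which \<open>P.subcring_iff\<close> applies, turning the
    subring property into \<open>cring\<close>.\<close>
  have "pullback A B \<alpha> \<beta> = (RDirProd A B)\<lparr>carrier := carrier (pullback A B \<alpha> \<beta>)\<rparr>"
    by (simp add: pullback_def)
  then show ?thesis
    using P.subcring_iff[OF S.subset] S.subcring_axioms by simp
qed

lemma pullback_fst_hom:
  "restrict fst (carrier (pullback A B \<alpha> \<beta>)) \<in> ring_hom (pullback A B \<alpha> \<beta>) A"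
  if "ring_hom_cring A C \<alpha>" "ring_hom_cring B C \<beta>"
proof -
  interpret P: cring "pullback A B \<alpha> \<beta>" by (rule pullback_cring) fact+
  show ?thesis
    \<comment> \<open>\<open>restrict\<close> evaluates to \<open>fst\<close> only on the carrier,
      so sums, products and the unit must be known to lie there.\<close>
    using P.a_closed P.m_closed P.one_closed
    by (intro ring_hom_memI) (auto simp: pullback_simps RDirProd_simps)
qed

theorem proposition4p7:
  fixes A :: "('a, 'm) ring_scheme"
    and B :: "('b, 'n) ring_scheme"
    and C :: "('c, 'k) ring_scheme"
    and \<alpha> :: "'a \<Rightarrow> 'c"
    and \<beta> :: "'b \<Rightarrow> 'c"
  assumes "cring A" and "cring B" and "cring C"
    and "\<alpha> \<in> ring_hom A C" and "\<beta> \<in> ring_hom B C"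
  shows "ring_retraction (pullback A B \<alpha> \<beta>) A (restrict fst (carrier (pullback A B \<alpha> \<beta>)))
    \<longleftrightarrow> (\<exists>J f. ideal J B \<and> f \<in> ring_hom A B \<and> pullback A B \<alpha> \<beta> = amalgamation A B f J)"
    (is "?retr \<longleftrightarrow> ?amalg")
proof -
  let ?P = "pullback A B \<alpha> \<beta>"
  interpret \<alpha>: ring_hom_cring A C \<alpha>
    by (intro ring_hom_cring.intro ring_hom_cring_axioms.intro) fact+
  interpret \<beta>: ring_hom_cring B C \<beta>
    by (intro ring_hom_cring.intro ring_hom_cring_axioms.intro) fact+
  note homs = \<alpha>.ring_hom_cring_axioms \<beta>.ring_hom_cring_axioms
  have fst_hom: "ring_hom_cring ?P A (restrict fst (carrier ?P))"
    by (intro ring_hom_cring.intro ring_hom_cring_axioms.intro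
        pullback_cring[OF homs] pullback_fst_hom[OF homs] assms(1))
  show ?thesis
  proof
    assume ?retr
    then obtain \<iota> where \<iota>: "\<iota> \<in> ring_hom A ?P"
      and fst_\<iota>: "\<forall>a \<in> carrier A. (restrict fst (carrier ?P) \<circ> \<iota>) a = a"
      unfolding ring_retraction_def by blast
    define f where "f = snd \<circ> \<iota>"
    \<comment> \<open>The section identity forces the first component to be \<open>a\<close>; it can
      be read off because \<open>\<iota> a\<close> lies in the carrier, where
      \<open>restrict\<close> acts as \<open>fst\<close>.\<close>
    have \<iota>_eq: "\<iota> a = (a, f a)" if "a \<in> carrier A" for a
      using bspec[OF fst_\<iota> that] ring_hom_closed[OF \<iota> that] by (simp add: f_def prod_eq_iff)
    have f_closed: "f a \<in> carrier B" and f_fibre: "\<beta> (f a) = \<alpha> a" if "a \<in> carrier A" for a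
      using ring_hom_closed[OF \<iota> that] that by (auto simp: \<iota>_eq pullback_simps)
    \<comment> \<open>Operations on pairs are componentwise, so each law for \<open>f\<close> is the
      second component of the same law for \<open>\<iota>\<close>.\<close>
    have f: "f \<in> ring_hom A B"
    proof (rule ring_hom_memI)
      fix x y assume [simp]: "x \<in> carrier A" "y \<in> carrier A"
      show "f (x \<otimes>\<^bsub>A\<^esub> y) = f x \<otimes>\<^bsub>B\<^esub> f y"
        using ring_hom_mult[OF \<iota>, of x y] by (simp add: \<iota>_eq pullback_simps RDirProd_simps)
      show "f (x \<oplus>\<^bsub>A\<^esub> y) = f x \<oplus>\<^bsub>B\<^esub> f y"
        using ring_hom_add[OF \<iota>, of x y] by (simp add: \<iota>_eq pullback_simps RDirProd_simps)
    next
      show "f \<one>\<^bsub>A\<^esub> = \<one>\<^bsub>B\<^esub>"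
        using ring_hom_one[OF \<iota>] by (simp add: \<iota>_eq pullback_simps RDirProd_simps)
    qed (rule f_closed)
    define J where "J = a_kernel B C \<beta>"
    have J: "j \<in> J \<longleftrightarrow> j \<in> carrier B \<and> \<beta> j = \<zero>\<^bsub>C\<^esub>" for j
      unfolding J_def a_kernel_def' by simp
    have "(a, b) \<in> {(a, f a \<oplus>\<^bsub>B\<^esub> j) | a j. a \<in> carrier A \<and> j \<in> J}"
      if "a \<in> carrier A" "b \<in> carrier B" "\<alpha> a = \<beta> b" for a b
    proof -
      \<comment> \<open>The only possible witness \<open>j\<close>; \<beta> kills it because
        \<open>\<beta> b = \<alpha> a = \<beta> (f a)\<close>.\<close>
      have "b \<ominus>\<^bsub>B\<^esub> f a \<in> J"
        using that f_closed f_fibre by (simp add: J a_minus_def \<alpha>.S.r_neg)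
      moreover have "b = f a \<oplus>\<^bsub>B\<^esub> (b \<ominus>\<^bsub>B\<^esub> f a)"
        using that f_closed by (simp add: a_minus_def \<beta>.R.a_lcomm \<beta>.R.r_neg)
      ultimately show ?thesis using that by blast
    qed
    then have "?P = amalgamation A B f J"
      \<comment> \<open>The inclusion just shown is half of the equality; the other half holds since
        \<open>\<beta> (f a \<oplus> j) = \<alpha> a\<close> for \<open>j\<close> in the
        kernel.\<close>
      unfolding pullback_eq_amalgamation_iff by (auto simp: J f_closed f_fibre)
    moreover have "ideal J B"
      unfolding J_def
      by (rule ring_hom_ring.kernel_is_ideal[OF ring_hom_ringI2])
        (rule \<beta>.R.ring_axioms \<alpha>.S.ring_axioms \<beta>.homh)+
    ultimately show ?amalg using f by blast
  next
    assume ?amalg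
    then obtain J f where J: "ideal J B" and f: "f \<in> ring_hom A B"
      and eq: "?P = amalgamation A B f J" by blast
    have graph: "(a, f a) \<in> carrier ?P" if "a \<in> carrier A" for a
    proof -
      \<comment> \<open>The choice \<open>j = 0\<close> puts the graph of \<open>f\<close> inside
        the amalgamation, hence inside the pullback.\<close>
      have "(a, f a \<oplus>\<^bsub>B\<^esub> \<zero>\<^bsub>B\<^esub>) \<in> carrier ?P"
        unfolding eq using that additive_subgroup.zero_closed[OF ideal.axioms(1)[OF J]]
        by (auto simp: amalgamation_def)
      then show ?thesis using ring_hom_closed[OF f that] by simp
    qed
    have "(\<lambda>a. (a, f a)) \<in> ring_hom A ?P"
      \<comment> \<open>Only the operations of the pullback are unfolded; its carrier stays folded
        so that \<open>graph\<close> supplies closure.\<close>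
      using graph by (intro ring_hom_memI)
        (auto simp: pullback_simps(2-4) RDirProd_simps
          ring_hom_add[OF f] ring_hom_mult[OF f] ring_hom_one[OF f])
    then show ?retr
      unfolding ring_retraction_def using fst_hom graph
      by (auto intro!: bexI[of _ "\<lambda>a. (a, f a)"])
  qed
qed

end
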